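(* Let $n\ge 1$ and let $\mathcal{D}(n)$ be the manifold of positive-definite Hermitian $n\times n$ complex matrices with trace one, equipped with the restriction of the Bures-Wasserstein metric $\mathfrak{g}^{BW}$. Then the Riemannian distance on $(\mathcal{D}(n),\mathfrak{g}^{BW})$ is given, for all $\rho_1,\rho_2\in\mathcal{D}(n)$, by $$d^{BW}_{\mathcal{D}(n)}(\rho_1,\rho_2)=\arccos\left(\operatorname{tr}\left(\left(\rho_2^{1/2}\rho_1\rho_2^{1/2}\right)^{1/2}\right)\right).$$
   Context: $\mathbb{H}(n)$ denotes the real vector space of Hermitian $n\times n$ complex matrices, $\mathbb{P}(n)\subset\mathbb{H}(n)$ the open subset of positive-definite ones, and $\mathcal{D}(n)=\{\rho\in\mathbb{P}(n):\operatorname{tr}\rho=1\}$. Square roots of positive-definite matrices are the positive-definite ones. Tangent spaces are identified with matrices: $T_\Sigma\mathbb{P}(n)\cong\mathbb{H}(n)$ and $T_\rho\mathcal{D}(n)\cong\{H\in\mathbb{H}(n):\operatorname{tr}H=0\}$. For $\Sigma\in\mathbb{P}(n)$ and $H\in\mathbb{H}(n)$, $\mathcal{L}_\Sigma(H)$ denotes the unique solution $X$ of the Lyapunov equation $\Sigma X+X\Sigma=H$. The Bures-Wasserstein metric on $\mathbb{P}(n)$ is the Riemannian metric $$\mathfrak{g}^{BW}_\Sigma(H,K)=\tfrac12\operatorname{Re}\operatorname{tr}(\mathcal{L}_\Sigma(H)K),\qquad H,K\in T_\Sigma\mathbb{P}(n),$$ and on $\mathcal{D}(n)$ one takes its restriction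 to the submanifold $\mathcal{D}(n)\subset\mathbb{P}(n)$. The Riemannian distance between two points of a Riemannian manifold is the infimum of the lengths of curves in that manifold joining them. *)

theory Defs
  imports "HOL-Analysis.Analysis"
begin

section \<open>Hermitian and positive-definite complex matrices\<close>

definition conj_transpose :: "complex^'n^'m \<Rightarrow> complex^'m^'n" where
  "conj_transpose A = map_matrix cnj (transpose A)"

definition hermitian :: "complex^'n^'n \<Rightarrow> bool" where
  "hermitian A \<longleftrightarrow> conj_transpose A = A"

text \<open>The quadratic form of a Hermitian matrix is real, so taking \<^const>\<open>Re\<close> loses nothing.\<close>

definition pos_def :: "complex^'n^'n \<Rightarrow> bool" where
  "pos_def A \<longleftrightarrow> hermitian A \<and>
     (\<forall>x. x \<noteq> 0 \<longrightarrow> 0 < Re (\<Sum>i\<in>UNIV. cnj (x $ i) * (A *v x) $ i))"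

definition density_matrices :: "(complex^'n^'n) set" where
  "density_matrices = {\<rho>. pos_def \<rho> \<and> trace \<rho> = 1}"

text \<open>The two definite descriptions below denote well-defined objects whenever \<open>A\<close> respectively
  \<open>S\<close> is positive definite; in the second, uniqueness holds among all complex matrices.\<close>

definition pd_sqrt :: "complex^'n^'n \<Rightarrow> complex^'n^'n" where
  "pd_sqrt A = (THE B. pos_def B \<and> B ** B = A)"

definition lyapunov :: "complex^'n^'n \<Rightarrow> complex^'n^'n \<Rightarrow> complex^'n^'n" where
  "lyapunov S H = (THE X. S ** X + X ** S = H)"

definition bures_wasserstein :: "complex^'n^'n \<Rightarrow> complex^'n^'n \<Rightarrow> complex^'n^'n \<Rightarrow> real" where
  "bures_wasserstein S H K = 1/2 * Re (trace (lyapunov S H ** K))"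


section \<open>Riemannian length and distance\<close>

text \<open>A metric on a submanifold \<open>M\<close> of a normed space is a function \<open>g p u v\<close> of a point \<open>p \<in> M\<close>
  and tangent vectors \<open>u\<close>, \<open>v\<close> at \<open>p\<close>. The velocity of a curve inside \<open>M\<close> is tangent to \<open>M\<close>, so
  the same \<open>g\<close> also serves as the restricted metric on any submanifold of \<open>M\<close>; the choice of \<open>M\<close>
  in the distance then determines which curves compete.

  Length is valued in the extended nonnegative reals because \<^const>\<open>valid_path\<close> does not bound
  the velocity near the finitely many break points: a curve of infinite length must get length
  \<open>\<infinity>\<close>, and not the default value \<open>0\<close> of a non-existing real integral. The value of the integrand
  at the break points is irrelevant.\<close>

definition curve_length ::
    "('a::real_normed_vector \<Rightarrow> 'a \<Rightarrow> 'a \<Rightarrow> real) \<Rightarrow> (real \<Rightarrow> 'a) \<Rightarrow> ennreal" where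
  "curve_length g \<gamma> =
     (\<integral>\<^sup>+t\<in>{0..1}. ennreal (sqrt (g (\<gamma> t) (vector_derivative \<gamma> (at t within {0..1}))
                                     (vector_derivative \<gamma> (at t within {0..1})))) \<partial>lborel)"

definition riemannian_distance ::
    "'a::real_normed_vector set \<Rightarrow> ('a \<Rightarrow> 'a \<Rightarrow> 'a \<Rightarrow> real) \<Rightarrow> 'a \<Rightarrow> 'a \<Rightarrow> ennreal" where
  "riemannian_distance M g p q =
     (INF \<gamma>\<in>{\<gamma>. valid_path \<gamma> \<and> path_image \<gamma> \<subseteq> M \<and> pathstart \<gamma> = p \<and> pathfinish \<gamma> = q}.
        curve_length g \<gamma>)"

end

theory Submission
  imports Defs
begin

text \<open>
  Write a density matrix as \<open>\<rho> = N N\<^sup>*\<close>. The amplitudes \<open>N\<close> of density matrices lie on the unit sphere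
  of the Hilbert-Schmidt norm, and \<open>N \<mapsto> N N\<^sup>*\<close> is a Riemannian submersion: the Bures-Wasserstein
  length of a tangent vector \<open>H\<close> at \<open>\<rho>\<close> is the norm of its horizontal lift \<open>X N\<close>, where \<open>X\<close> solves the
  Lyapunov equation (\<open>bures_wasserstein_eq_norm\<close>). The distance is thus the smallest spherical
  distance between amplitudes of \<open>\<rho>\<^sub>1\<close> and \<open>\<rho>\<^sub>2\<close>. With \<open>s = \<rho>\<^sub>2\<^sup>1\<^sup>/\<^sup>2\<close> and the positive definite \<open>T\<close> such that
  \<open>T \<rho>\<^sub>2 T = \<rho>\<^sub>1\<close>, the amplitudes \<open>T s\<close> and \<open>s\<close> are aligned, and the cosine of their angle is the
  fidelity \<open>tr ((s \<rho>\<^sub>1 s)\<^sup>1\<^sup>/\<^sup>2)\<close> (\<open>fidelity_lift\<close>).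

  For the upper bound, the great circle from \<open>T s\<close> to \<open>s\<close> is horizontal, stays over positive definite
  matrices and projects to a curve of the required length (\<open>great_circle_path\<close>).

  For the lower bound, lifting an arbitrary curve would require solving a differential equation
  that may be singular at the break points of the curve. Instead the fidelity \<open>F\<close> between the moving
  point and \<open>\<rho>\<^sub>2\<close> is differentiated. At each time its derivative is the inner product of \<open>s\<close> with the
  horizontal velocity at the amplitude aligned with \<open>s\<close>, and Cauchy-Schwarz bounds it by the speed
  times \<open>sqrt (1 - F\<^sup>2)\<close> (\<open>fidelity_derivative\<close>). Hence \<open>arccos F\<close>, which vanishes at the end of the
  curve, changes by at most the length (\<open>arccos_fidelity_le_curve_length\<close>).

  The matrix analysis rests on one fact, that a Sylvester equation with accretive coefficients has
  only the trivial homogeneous solution (\<open>sylvester_eq_0\<close>). It gives the unique solution of the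
  Lyapunov equation, the uniqueness of square roots, and, by the inverse function theorem, their
  differentiability (\<open>has_vector_derivative_pd_sqrt\<close>). Square roots exist by Banach's fixed point
  theorem (\<open>pos_def_sqrt_exists\<close>).
\<close>

section \<open>Adjoints, traces and the Hilbert-Schmidt product\<close>

lemma conj_transpose_nth [simp]: "conj_transpose A $ i $ j = cnj (A $ j $ i)"
  by (simp add: conj_transpose_def transpose_def)

lemma conj_transpose_conj_transpose [simp]: "conj_transpose (conj_transpose A) = A"
  by (simp add: vec_eq_iff)

lemma conj_transpose_mult: "conj_transpose (A ** B) = conj_transpose B ** conj_transpose A"
  by (simp add: vec_eq_iff matrix_matrix_mult_def mult.commute)

lemma conj_transpose_add: "conj_transpose (A + B) = conj_transpose A + conj_transpose B"
  by (simp add: vec_eq_iff)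

lemma conj_transpose_diff: "conj_transpose (A - B) = conj_transpose A - conj_transpose B"
  by (simp add: vec_eq_iff)

lemma conj_transpose_scaleR: "conj_transpose (r *\<^sub>R A) = r *\<^sub>R conj_transpose A"
  by (simp add: vec_eq_iff)

lemma conj_transpose_mat_1 [simp]: "conj_transpose (mat 1) = mat 1"
  by (simp add: vec_eq_iff mat_def)

lemma bounded_linear_conj_transpose: "bounded_linear (conj_transpose :: complex^'n^'m \<Rightarrow> _)"
  by (auto intro!: linear_conv_bounded_linear[THEN iffD1] linearI
      simp: conj_transpose_add conj_transpose_scaleR)

lemma matrix_mult_add_left: "((A :: complex^'n^'m) + B) ** C = A ** C + B ** C"
  by (simp add: vec_eq_iff matrix_matrix_mult_def sum.distrib algebra_simps)

lemma matrix_mult_diff_left: "((A :: complex^'n^'m) - B) ** C = A ** C - B ** C"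
  by (simp add: vec_eq_iff matrix_matrix_mult_def sum_subtractf algebra_simps)

lemma matrix_mult_diff_right: "(C :: complex^'n^'m) ** (A - B) = C ** A - C ** B"
  by (simp add: vec_eq_iff matrix_matrix_mult_def sum_subtractf algebra_simps)

lemma matrix_mult_scaleR_left: "(r *\<^sub>R (A :: complex^'n^'m)) ** B = r *\<^sub>R (A ** B)"
  by (simp add: scalar_matrix_assoc)

lemma matrix_mult_scaleR_right: "(A :: complex^'n^'m) ** (r *\<^sub>R B) = r *\<^sub>R (A ** B)"
  by (simp add: matrix_scalar_ac scalar_matrix_assoc)

lemmas matrix_algebra = matrix_mult_add_left matrix_add_ldistrib matrix_mult_diff_left
  matrix_mult_diff_right matrix_mult_scaleR_left matrix_mult_scaleR_right

lemma bounded_bilinear_matrix_mult: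
  "bounded_bilinear ((**) :: complex^'n^'m \<Rightarrow> complex^'p^'n \<Rightarrow> _)"
  by (auto simp: bilinear_conv_bounded_bilinear[symmetric] bilinear_def matrix_algebra
      intro!: linearI)

lemma matrix_vector_mult_scaleR_left:
  "(r *\<^sub>R (A :: complex^'n^'m)) *v x = r *\<^sub>R (A *v x)"
  by (simp add: vec_eq_iff matrix_vector_mult_def scaleR_sum_right)

lemma matrix_vector_mult_scaleR_right:
  "(A :: complex^'n^'m) *v (r *\<^sub>R x) = r *\<^sub>R (A *v x)"
  by (rule linear_scale[OF matrix_vector_mul_linear])

lemma bounded_bilinear_matrix_vector_mult:
  "bounded_bilinear ((*v) :: complex^'n^'m \<Rightarrow> complex^'n \<Rightarrow> _)"
  by (auto simp: bilinear_conv_bounded_bilinear[symmetric] bilinear_def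
      matrix_vector_mult_add_rdistrib matrix_vector_right_distrib matrix_vector_mult_scaleR_right
      matrix_vector_mult_scaleR_left intro!: linearI)

lemma bounded_linear_trace: "bounded_linear (trace :: complex^'n^'n \<Rightarrow> complex)"
  by (auto intro!: linear_conv_bounded_linear[THEN iffD1] linearI
      simp: trace_def sum.distrib scaleR_sum_right)

lemma trace_conj_transpose: "trace (conj_transpose A) = cnj (trace A)"
  by (simp add: trace_def)

text \<open>The euclidean structure that the matrix type carries is the real part of the Hilbert-Schmidt
  product, so norms of amplitudes can be computed with traces.\<close>

lemma inner_matrix_eq_trace:
  fixes A B :: "complex^'n^'m"
  shows "A \<bullet> B = Re (trace (conj_transpose A ** B))"
proof -
  have "A \<bullet> B = (\<Sum>i\<in>UNIV. \<Sum>j\<in>UNIV. Re (cnj (A $ i $ j) * B $ i $ j))"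
    by (simp add: inner_vec_def inner_complex_def)
  also have "\<dots> = (\<Sum>j\<in>UNIV. \<Sum>i\<in>UNIV. Re (cnj (A $ i $ j) * B $ i $ j))"
    by (rule sum.swap)
  also have "\<dots> = Re (trace (conj_transpose A ** B))"
    by (simp add: trace_def matrix_matrix_mult_def)
  finally show ?thesis .
qed

lemma trace_mult_conj_transpose:
  fixes A :: "complex^'n^'m"
  shows "trace (A ** conj_transpose A) = of_real (A \<bullet> A)"
  by (simp add: trace_def matrix_matrix_mult_def inner_vec_def complex_mult_cnj
      power2_eq_square inner_complex_def)

lemma inner_conj_transpose:
  fixes A :: "complex^'n^'m"
  shows "conj_transpose A \<bullet> conj_transpose B = A \<bullet> B"
proof -
  have "conj_transpose A \<bullet> conj_transpose B = Re (trace (conj_transpose B ** A))"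
    by (simp add: inner_matrix_eq_trace trace_mul_sym[of A])
  also have "\<dots> = A \<bullet> B"
    by (metis inner_matrix_eq_trace inner_commute)
  finally show ?thesis .
qed

lemma inner_vector_eq:
  fixes x y :: "complex^'n"
  shows "x \<bullet> y = Re (\<Sum>i\<in>UNIV. cnj (x $ i) * y $ i)"
  by (simp add: inner_vec_def inner_complex_def)

lemma inner_matrix_vector_mult:
  fixes A :: "complex^'n^'m"
  shows "x \<bullet> (A *v y) = (conj_transpose A *v x) \<bullet> y"
proof -
  have "x \<bullet> (A *v y) = Re (\<Sum>i\<in>UNIV. \<Sum>j\<in>UNIV. cnj (x $ i) * (A $ i $ j * y $ j))"
    by (simp add: inner_vector_eq matrix_vector_mult_def sum_distrib_left del: Re_sum)
  also have "\<dots> = Re (\<Sum>j\<in>UNIV. \<Sum>i\<in>UNIV. cnj (x $ i) * (A $ i $ j * y $ j))"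
    by (subst sum.swap) simp
  also have "\<dots> = (conj_transpose A *v x) \<bullet> y"
    by (simp add: inner_vector_eq matrix_vector_mult_def sum_distrib_right sum_distrib_left
        mult_ac del: Re_sum)
  finally show ?thesis .
qed

lemma inner_eq_sum_columns:
  fixes A B :: "complex^'n^'m"
  shows "A \<bullet> B = (\<Sum>j\<in>UNIV. column j A \<bullet> column j B)"
  unfolding inner_vec_def column_def by (simp add: sum.swap[of _ "UNIV::'n set"])

lemma column_mult: "column j (A ** B) = A *v column j B"
  by (simp add: column_def matrix_matrix_mult_def matrix_vector_mult_def vec_eq_iff)

text \<open>Column by column, the norm of the type (the Frobenius norm) of a product is bounded by the
  operator norm of the left factor times the Frobenius norm of the right one. This mixed estimate
  makes a map contracting in the Frobenius norm although only operator norms are known to be small.\<close>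

lemma norm_mult_le_of_pointwise:
  fixes A :: "complex^'n^'m" and B :: "complex^'p^'n"
  assumes "\<And>x. norm (A *v x) \<le> r * norm x" "0 \<le> r"
  shows "norm (A ** B) \<le> r * norm B"
proof (rule power2_le_imp_le)
  have "(norm (A ** B))\<^sup>2 = (\<Sum>j\<in>UNIV. (norm (A *v column j B))\<^sup>2)"
    by (simp add: power2_norm_eq_inner inner_eq_sum_columns[of "A ** B"] column_mult)
  also have "\<dots> \<le> (\<Sum>j\<in>UNIV. (r * norm (column j B))\<^sup>2)"
    by (intro sum_mono power_mono assms) auto
  also have "\<dots> = (r * norm B)\<^sup>2"
    by (simp add: power_mult_distrib sum_distrib_left[symmetric] power2_norm_eq_inner
        inner_eq_sum_columns[of B])
  finally show "(norm (A ** B))\<^sup>2 \<le> (r * norm B)\<^sup>2" .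
  show "0 \<le> r * norm B" using assms by simp
qed

section \<open>Accretive matrices and the Lyapunov equation\<close>

text \<open>Positivity of the real quadratic form for matrices that may fail to be Hermitian. In contrast to
  positive definiteness this is an open condition among all complex matrices, as required for
  differentiating the square root with the inverse function theorem.\<close>

definition accretive :: "complex^'n^'n \<Rightarrow> bool" where
  "accretive A \<longleftrightarrow> (\<forall>x. x \<noteq> 0 \<longrightarrow> 0 < x \<bullet> (A *v x))"

lemma pos_def_iff: "pos_def A \<longleftrightarrow> hermitian A \<and> accretive A"
  by (simp add: pos_def_def accretive_def inner_vector_eq)

lemma pos_def_hermitian: "pos_def A \<Longrightarrow> hermitian A"
  by (simp add: pos_def_def)

lemma pos_def_accretive: "pos_def A \<Longrightarrow> accretive A"
  by (simp add: pos_def_iff)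

lemma pos_def_conj_transpose: "pos_def A \<Longrightarrow> conj_transpose A = A"
  by (simp add: pos_def_def hermitian_def)

lemma accretive_mat_1: "accretive (mat 1)"
  by (simp add: accretive_def)

lemma accretive_conj_transpose: "accretive A \<Longrightarrow> accretive (conj_transpose A)"
  by (simp add: accretive_def inner_matrix_vector_mult[of _ "conj_transpose A"])
    (simp add: inner_commute)

lemma accretive_nonneg: "accretive A \<Longrightarrow> 0 \<le> x \<bullet> (A *v x)"
  by (cases "x = 0") (auto simp: accretive_def less_imp_le)

lemma accretive_inner_left:
  fixes Y :: "complex^'p^'n"
  assumes "accretive A" "Y \<noteq> 0"
  shows "0 < Y \<bullet> (A ** Y)"
proof -
  obtain j where "column j Y \<noteq> 0"
    using assms(2) by (auto simp: vec_eq_iff column_def)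
  then have "0 < (\<Sum>j\<in>UNIV. column j Y \<bullet> (A *v column j Y))"
    using assms(1) by (intro sum_pos2[of _ j] accretive_nonneg) (auto simp: accretive_def)
  then show ?thesis
    by (simp add: inner_eq_sum_columns[of Y] column_mult)
qed

lemma accretive_inner_right:
  fixes Y :: "complex^'n^'p"
  assumes "accretive A" "Y \<noteq> 0"
  shows "0 < Y \<bullet> (Y ** A)"
proof -
  have "conj_transpose Y \<noteq> 0"
    using assms(2) by (auto simp: vec_eq_iff)
  then have "0 < conj_transpose Y \<bullet> (conj_transpose A ** conj_transpose Y)"
    by (intro accretive_inner_left accretive_conj_transpose assms)
  then show ?thesis
    by (simp add: conj_transpose_mult[symmetric] inner_conj_transpose)
qed

text \<open>Pairing the equation with \<open>Y\<close> gives a sum of two numbers that are both positive unless \<open>Y = 0\<close>.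
  Uniqueness of square roots and solvability of the Lyapunov equation both come from here.\<close>

lemma sylvester_eq_0:
  assumes "accretive A" "accretive B" "A ** Y + Y ** B = 0"
  shows "Y = 0"
proof (rule ccontr)
  assume "Y \<noteq> 0"
  then have "0 < Y \<bullet> (A ** Y) + Y \<bullet> (Y ** B)"
    using accretive_inner_left[OF assms(1)] accretive_inner_right[OF assms(2)] by (intro add_pos_pos)
  also have "\<dots> = Y \<bullet> (A ** Y + Y ** B)"
    by (rule inner_add_right[symmetric])
  finally show False
    by (simp only: assms(3) inner_zero_right)
qed

text \<open>The difference of two square roots of the same matrix solves a homogeneous Sylvester equation.\<close>

lemma accretive_square_inj:
  assumes "accretive A" "accretive B" "A ** A = B ** B"
  shows "A = B"
proof -
  have "A ** (A - B) + (A - B) ** B = 0"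
    by (simp add: matrix_algebra assms(3))
  then show ?thesis
    using sylvester_eq_0[OF assms(1,2), of "A - B"] by simp
qed

lemma lyapunov_eqI:
  assumes "accretive S" "S ** X + X ** S = H"
  shows "lyapunov S H = X"
  unfolding lyapunov_def
proof (rule the_equality)
  fix Z assume "S ** Z + Z ** S = H"
  with assms(2) have "(S ** Z + Z ** S) - (S ** X + X ** S) = 0"
    by simp
  then have "S ** (Z - X) + (Z - X) ** S = 0"
    by (simp only: matrix_algebra) (simp add: algebra_simps)
  then show "Z = X"
    using sylvester_eq_0[OF assms(1,1), of "Z - X"] by simp
qed (fact assms)

text \<open>The Lyapunov operator is an injective linear endomorphism of a finite-dimensional space, hence
  surjective.\<close>

lemma lyapunov_solves:
  fixes S :: "complex^'n^'n"
  assumes "accretive S"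
  shows "S ** lyapunov S H + lyapunov S H ** S = H"
proof -
  let ?f = "\<lambda>X. S ** X + X ** S"
  have lin: "linear ?f"
    by (intro linearI) (simp_all add: matrix_algebra algebra_simps)
  have "inj ?f"
    by (rule linear_injective_0[OF lin, THEN iffD2]) (blast intro: sylvester_eq_0[OF assms assms])
  with lin have "surj ?f"
    by (rule linear_injective_imp_surjective) simp
  then obtain X where "H = ?f X"
    by (rule surjE)
  with lyapunov_eqI[OF assms] show ?thesis by metis
qed

lemma linear_lyapunov:
  assumes "accretive S"
  shows "linear (lyapunov S)"
proof (intro linearI lyapunov_eqI[OF assms])
  fix H K r
  have "S ** (lyapunov S H + lyapunov S K) + (lyapunov S H + lyapunov S K) ** S
    = (S ** lyapunov S H + lyapunov S H ** S) + (S ** lyapunov S K + lyapunov S K ** S)"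
    by (simp add: matrix_algebra)
  then show "S ** (lyapunov S H + lyapunov S K) + (lyapunov S H + lyapunov S K) ** S = H + K"
    by (simp only: lyapunov_solves[OF assms])
  have "S ** (r *\<^sub>R lyapunov S H) + (r *\<^sub>R lyapunov S H) ** S
    = r *\<^sub>R (S ** lyapunov S H + lyapunov S H ** S)"
    by (simp add: matrix_algebra scaleR_add_right)
  then show "S ** (r *\<^sub>R lyapunov S H) + (r *\<^sub>R lyapunov S H) ** S = r *\<^sub>R H"
    by (simp only: lyapunov_solves[OF assms])
qed

text \<open>Transposing the Lyapunov equation shows that the adjoint of the solution is a solution too.\<close>

lemma hermitian_lyapunov:
  assumes "pos_def S" "hermitian H"
  shows "hermitian (lyapunov S H)"
proof -
  have S: "accretive S" "conj_transpose S = S" and H: "conj_transpose H = H"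
    using assms by (auto simp: pos_def_iff hermitian_def)
  have "S ** conj_transpose (lyapunov S H) + conj_transpose (lyapunov S H) ** S
      = conj_transpose (S ** lyapunov S H + lyapunov S H ** S)"
    by (simp add: conj_transpose_add conj_transpose_mult S add.commute)
  also have "\<dots> = H"
    by (simp add: lyapunov_solves S H)
  finally have "lyapunov S H = conj_transpose (lyapunov S H)"
    by (rule lyapunov_eqI[OF S(1)])
  then show ?thesis
    by (simp add: hermitian_def)
qed

text \<open>The quadratic form attains a positive minimum on the compact unit sphere.\<close>

lemma accretive_coercive:
  fixes A :: "complex^'n^'n"
  assumes "accretive A"
  obtains c where "0 < c" "\<And>x. c * (norm x)\<^sup>2 \<le> x \<bullet> (A *v x)"
proof -
  let ?S = "sphere 0 1 :: (complex^'n) set"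
  have "continuous_on ?S (\<lambda>x. x \<bullet> (A *v x))"
    by (intro continuous_intros bounded_linear.continuous_on[OF matrix_vector_mul_bounded_linear])
  moreover have "axis undefined 1 \<in> ?S"
    by simp
  ultimately obtain z where z: "z \<in> ?S" "\<And>x. x \<in> ?S \<Longrightarrow> z \<bullet> (A *v z) \<le> x \<bullet> (A *v x)"
    using continuous_attains_inf[OF compact_sphere, of 0 1 "\<lambda>x. x \<bullet> (A *v x)"] by blast
  show ?thesis
  proof (rule that)
    show "0 < z \<bullet> (A *v z)"
      using assms z(1) unfolding accretive_def by (metis mem_sphere_0 norm_zero zero_neq_one)
    fix x :: "complex^'n"
    show "(z \<bullet> (A *v z)) * (norm x)\<^sup>2 \<le> x \<bullet> (A *v x)"
    proof (cases "x = 0")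
      case False
      then have "z \<bullet> (A *v z) \<le> (x /\<^sub>R norm x) \<bullet> (A *v (x /\<^sub>R norm x))"
        by (intro z) simp
      also have "\<dots> = (x \<bullet> (A *v x)) / (norm x)\<^sup>2"
        by (simp add: matrix_vector_mult_scaleR_right power2_eq_square divide_simps)
      finally show ?thesis
        using False by (simp add: field_simps)
    qed simp
  qed
qed

lemma open_accretive: "open {A :: complex^'n^'n. accretive A}"
  unfolding open_dist
proof safe
  fix A :: "complex^'n^'n" assume "accretive A"
  then obtain c where c: "0 < c" "\<And>x. c * (norm x)\<^sup>2 \<le> x \<bullet> (A *v x)"
    using accretive_coercive by blast
  obtain K where K: "0 < K" "\<And>(D::complex^'n^'n) x. norm (D *v x) \<le> norm D * norm x * K"
    using bounded_bilinear.pos_bounded[OF bounded_bilinear_matrix_vector_mult] by blast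
  show "\<exists>e>0. \<forall>B. dist B A < e \<longrightarrow> B \<in> {A. accretive A}"
  proof (intro exI[of _ "c / K"] conjI allI impI)
    show "0 < c / K" using c K by simp
    fix B assume B: "dist B A < c / K"
    show "B \<in> {A. accretive A}"
      unfolding accretive_def
    proof (intro CollectI allI impI)
      fix x :: "complex^'n" assume x: "x \<noteq> 0"
      have "- (x \<bullet> ((B - A) *v x)) \<le> norm x * norm ((B - A) *v x)"
        using norm_cauchy_schwarz[of "- x"] by (metis inner_minus_left norm_minus_cancel)
      also have "\<dots> \<le> norm x * (norm (B - A) * norm x * K)"
        by (intro mult_left_mono K) auto
      also have "\<dots> = norm (B - A) * K * (norm x)\<^sup>2"
        by (simp add: power2_eq_square)
      also have "\<dots> < c * (norm x)\<^sup>2"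
        using B x K(1) by (intro mult_strict_right_mono) (auto simp: dist_norm field_simps)
      also have "\<dots> \<le> x \<bullet> (A *v x)"
        by (rule c)
      finally show "0 < x \<bullet> (B *v x)"
        by (simp add: matrix_vector_mult_diff_rdistrib inner_diff_right)
    qed
  qed
qed

lemma accretive_congruence:
  assumes "accretive A" "B ** C = mat 1"
  shows "accretive (conj_transpose C ** A ** C)"
  unfolding accretive_def
proof (intro allI impI)
  fix x :: "complex^'b" assume "x \<noteq> 0"
  then have "C *v x \<noteq> 0"
    using assms(2) by (metis matrix_vector_mul_assoc matrix_vector_mul_lid matrix_vector_mult_0_right)
  then show "0 < x \<bullet> (conj_transpose C ** A ** C *v x)"
    using assms(1)
    by (simp add: accretive_def matrix_vector_mul_assoc[symmetric]
        inner_matrix_vector_mult[of _ "conj_transpose C"])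
qed

lemma accretive_inverse:
  fixes A :: "complex^'n^'n"
  assumes "accretive A"
  obtains B where "A ** B = mat 1" "B ** A = mat 1"
proof -
  have "inj ((*v) A)"
  proof (rule linear_injective_0[OF matrix_vector_mul_linear, THEN iffD2], safe)
    fix x assume "A *v x = 0"
    then have "x \<bullet> (A *v x) = 0" by simp
    with assms show "x = 0" by (auto simp: accretive_def)
  qed
  then show ?thesis
    using matrix_left_invertible_injective[of A] matrix_left_right_inverse[of A] that by blast
qed

lemma pos_def_inverse:
  assumes "pos_def A"
  obtains B where "A ** B = mat 1" "B ** A = mat 1" "hermitian B"
proof -
  obtain B where B: "A ** B = mat 1" "B ** A = mat 1"
    using assms accretive_inverse by (auto simp: pos_def_iff)
  have "conj_transpose B ** A = mat 1"
    using arg_cong[OF B(1), of conj_transpose] assms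
    by (simp add: conj_transpose_mult pos_def_def hermitian_def)
  then have "conj_transpose B = B"
    by (metis B(1) matrix_mul_assoc matrix_mul_lid matrix_mul_rid)
  with B that show ?thesis by (auto simp: hermitian_def)
qed

lemma pos_def_congruence:
  assumes "pos_def A" "hermitian C" "B ** C = mat 1"
  shows "pos_def (C ** A ** C)"
  using accretive_congruence[of A B C] assms
  by (simp add: pos_def_iff hermitian_def conj_transpose_mult matrix_mul_assoc)

section \<open>The square root and its derivative\<close>

text \<open>Rescale \<open>A\<close> so that \<open>K = 1 - e A\<close> has operator norm at most \<open>k < 1\<close>. A square root \<open>1 - Y\<close> of \<open>e A = 1 - K\<close>
  is the same as a fixed point of \<open>f Y = (K + Y\<^sup>2) / 2\<close>. If \<open>r < 1\<close> solves the scalar equation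
  \<open>r = (k + r\<^sup>2) / 2\<close>, then \<open>f\<close> preserves the Hermitian matrices of operator norm at most \<open>r\<close> and
  contracts the Frobenius distance between them by the factor \<open>r\<close>.\<close>

lemma pos_def_sqrt_exists:
  fixes A :: "complex^'n^'n"
  assumes "pos_def A"
  obtains B where "pos_def B" "B ** B = A"
proof -
  have herm: "conj_transpose A = A" and "accretive A"
    using assms by (auto simp: pos_def_iff hermitian_def)
  obtain c where c: "0 < c" "\<And>x. c * (norm x)\<^sup>2 \<le> x \<bullet> (A *v x)"
    using accretive_coercive[OF \<open>accretive A\<close>] by blast
  obtain C0 where C0: "0 < C0" "\<And>x. norm (A *v x) \<le> norm x * C0"
    using bounded_linear.pos_bounded[OF matrix_vector_mul_bounded_linear[of A]] by blast
  \<comment> \<open>Adding \<open>c\<close> to the bound makes the quotient \<open>c / C\<close> smaller than \<open>1\<close>.\<close>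
  define C where "C = C0 + c"
  have C: "0 < c" "c < C" "norm (A *v x) \<le> C * norm x" for x
    using c C0(1) C0(2)[of x] by (auto simp: C_def algebra_simps intro: order_trans)
  \<comment> \<open>This \<open>e\<close> minimizes the bound \<open>1 - 2 e c + e\<^sup>2 C\<^sup>2\<close> for the squared operator norm of \<open>1 - e A\<close>.\<close>
  define e where "e = c / C\<^sup>2"
  define k where "k = sqrt (1 - (c / C)\<^sup>2)"
  \<comment> \<open>The smaller root of \<open>r\<^sup>2 - 2 r + k = 0\<close>.\<close>
  define r where "r = 1 - sqrt (1 - k)"
  define K where "K = mat 1 - e *\<^sub>R A"
  have e: "0 < e"
    using C by (simp add: e_def)
  have q: "0 < (c / C)\<^sup>2" "(c / C)\<^sup>2 < 1"
    using C by (auto simp: power_less_one_iff)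
  have k: "0 \<le> k" "k < 1" "k\<^sup>2 = 1 - (c / C)\<^sup>2"
    using q by (auto simp: k_def)
  have r: "0 \<le> r" "r < 1" "k + r\<^sup>2 = 2 * r"
    using k by (auto simp: r_def power2_diff)
  have normK: "norm (K *v x) \<le> k * norm x" for x
  proof (rule power2_le_imp_le)
    have "(norm (K *v x))\<^sup>2 = (norm x)\<^sup>2 - 2 * e * (x \<bullet> (A *v x)) + e\<^sup>2 * (norm (A *v x))\<^sup>2"
      unfolding power2_norm_eq_inner
      by (simp add: K_def matrix_vector_mult_diff_rdistrib matrix_vector_mult_scaleR_left
          inner_diff_left inner_diff_right inner_commute[of "A *v x" x] power2_eq_square
          right_diff_distrib)
    also have "\<dots> \<le> (norm x)\<^sup>2 - 2 * e * (c * (norm x)\<^sup>2) + e\<^sup>2 * (C * norm x)\<^sup>2"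
      using e c(2)[of x] C(3)[of x] by (intro add_mono diff_mono mult_left_mono power_mono) auto
    also have "\<dots> = (k * norm x)\<^sup>2"
      unfolding power_mult_distrib k(3) e_def using C by (simp add: field_simps power2_eq_square)
    finally show "(norm (K *v x))\<^sup>2 \<le> (k * norm x)\<^sup>2" .
  qed (use k in simp)
  define f where "f Y = (1/2) *\<^sub>R (K + Y ** Y)" for Y :: "complex^'n^'n"
  define S where "S = {Y :: complex^'n^'n. conj_transpose Y = Y \<and> (\<forall>x. norm (Y *v x) \<le> r * norm x)}"
  have "closed S"
    unfolding S_def
    by (intro closed_Collect_conj closed_Collect_all closed_Collect_eq closed_Collect_le continuous_intros
        bounded_linear.continuous_on[OF bounded_linear_conj_transpose]
        bounded_bilinear.continuous_on[OF bounded_bilinear_matrix_vector_mult])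
  moreover have "0 \<in> S"
    using r by (auto simp: S_def vec_eq_iff)
  moreover have "f Y \<in> S" if Y: "Y \<in> S" for Y
  proof -
    have "norm (f Y *v x) \<le> r * norm x" for x
    proof -
      have "norm (Y *v (Y *v x)) \<le> r * (r * norm x)"
        using Y r(1) by (auto simp: S_def intro: order_trans[OF _ mult_left_mono])
      then have "norm (K *v x + Y *v (Y *v x)) \<le> k * norm x + r\<^sup>2 * norm x"
        using normK[of x] by (intro norm_triangle_le) (auto simp: power2_eq_square)
      also have "\<dots> = 2 * (r * norm x)"
        by (simp add: distrib_right[symmetric] r(3))
      finally show ?thesis
        by (simp add: f_def matrix_vector_mult_scaleR_left matrix_vector_mult_add_rdistrib
            matrix_vector_mul_assoc)
    qed
    moreover have "conj_transpose (f Y) = f Y"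
      using Y by (simp add: S_def f_def K_def conj_transpose_scaleR conj_transpose_add
          conj_transpose_diff conj_transpose_mult herm)
    ultimately show ?thesis by (simp add: S_def)
  qed
  moreover have "dist (f Y) (f Z) \<le> r * dist Y Z" if Y: "Y \<in> S" and Z: "Z \<in> S" for Y Z
  proof -
    have left: "norm (Y ** (Y - Z)) \<le> r * norm (Y - Z)"
      using Y r(1) by (intro norm_mult_le_of_pointwise) (auto simp: S_def)
    \<comment> \<open>Right multiplication by \<open>Z\<close> becomes left multiplication after taking adjoints.\<close>
    have "norm ((Y - Z) ** Z) = norm (conj_transpose ((Y - Z) ** Z))"
      by (simp add: norm_eq_sqrt_inner inner_conj_transpose)
    also have "\<dots> = norm (Z ** (Y - Z))"
      using Y Z by (simp add: S_def conj_transpose_mult conj_transpose_diff)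
    also have "\<dots> \<le> r * norm (Y - Z)"
      using Z r(1) by (intro norm_mult_le_of_pointwise) (auto simp: S_def)
    finally have right: "norm ((Y - Z) ** Z) \<le> r * norm (Y - Z)" .
    have "f Y - f Z = (1/2) *\<^sub>R (Y ** (Y - Z) + (Y - Z) ** Z)"
      by (simp add: f_def matrix_algebra scaleR_diff_right[symmetric])
    then have "dist (f Y) (f Z) = (1/2) * norm (Y ** (Y - Z) + (Y - Z) ** Z)"
      by (simp add: dist_norm)
    also have "\<dots> \<le> (1/2) * (r * norm (Y - Z) + r * norm (Y - Z))"
      using left right by (intro mult_left_mono norm_triangle_le add_mono) auto
    finally show ?thesis by (simp add: dist_norm)
  qed
  ultimately obtain Y where Y: "Y \<in> S" "f Y = Y"
    using Banach_fix[of S r f] r by (auto simp: complete_eq_closed)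
  have "2 *\<^sub>R Y = 2 *\<^sub>R f Y" by (simp add: Y)
  then have Y2: "Y ** Y = 2 *\<^sub>R Y - K"
    by (simp add: f_def)
  have sq: "(mat 1 - Y) ** (mat 1 - Y) = e *\<^sub>R A"
    by (simp add: matrix_algebra Y2 K_def algebra_simps scaleR_2)
  have pos: "0 < x \<bullet> ((mat 1 - Y) *v x)" if "x \<noteq> 0" for x
  proof -
    have "x \<bullet> (Y *v x) \<le> norm x * (r * norm x)"
      using Y(1) by (intro order_trans[OF norm_cauchy_schwarz] mult_left_mono) (auto simp: S_def)
    also have "\<dots> < x \<bullet> x"
      using that r by (simp add: power2_norm_eq_inner[symmetric] power2_eq_square)
    finally show ?thesis
      by (simp add: matrix_vector_mult_diff_rdistrib inner_diff_right)
  qed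
  show ?thesis
  proof (rule that)
    show "pos_def ((1 / sqrt e) *\<^sub>R (mat 1 - Y))"
      using Y(1) e pos by (simp add: pos_def_iff hermitian_def accretive_def S_def conj_transpose_scaleR
          conj_transpose_diff matrix_vector_mult_scaleR_left)
    show "((1 / sqrt e) *\<^sub>R (mat 1 - Y)) ** ((1 / sqrt e) *\<^sub>R (mat 1 - Y)) = A"
      using e by (simp add: matrix_mult_scaleR_left matrix_mult_scaleR_right sq)
  qed
qed

lemma pd_sqrt_eqI:
  assumes "pos_def B" "B ** B = A"
  shows "pd_sqrt A = B"
  unfolding pd_sqrt_def using assms
  by (intro the_equality) (auto intro: accretive_square_inj simp: pos_def_iff)

lemma
  assumes "pos_def A"
  shows pos_def_pd_sqrt: "pos_def (pd_sqrt A)"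
    and pd_sqrt_square: "pd_sqrt A ** pd_sqrt A = A"
  using pos_def_sqrt_exists[OF assms] pd_sqrt_eqI by metis+

lemma has_derivative_square:
  "((\<lambda>B :: complex^'n^'n. B ** B) has_derivative (\<lambda>H. B ** H + H ** B)) (at B)"
  by (rule bounded_bilinear.FDERIV[OF bounded_bilinear_matrix_mult has_derivative_ident
        has_derivative_ident])

text \<open>Squaring is injective on the open set of accretive matrices and its derivative at \<open>B\<close> is the
  invertible operator \<open>H \<mapsto> B H + H B\<close>. The inverse function theorem makes the inverse on this set
  differentiable, with the Lyapunov operator as derivative. Passing to an extension is necessary
  because the Hermitian matrices have empty interior in the space of all complex matrices.\<close>

lemma pd_sqrt_differentiable_extension:
  obtains g :: "complex^'n^'n \<Rightarrow> complex^'n^'n" where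
    "\<And>A. pos_def A \<Longrightarrow> g A = pd_sqrt A"
    "\<And>A. pos_def A \<Longrightarrow> (g has_derivative lyapunov (pd_sqrt A)) (at A)"
proof
  let ?S = "{B :: complex^'n^'n. accretive B}"
  let ?sq = "\<lambda>B :: complex^'n^'n. B ** B"
  have "inj_on ?sq ?S"
    by (auto intro!: inj_onI accretive_square_inj)
  then have g: "inv_into ?S ?sq (B ** B) = B" if "B \<in> ?S" for B
    using inv_into_f_f[of ?sq ?S B] that by blast
  fix A :: "complex^'n^'n" assume "pos_def A"
  note A = pos_def_pd_sqrt[OF this] pd_sqrt_square[OF this]
  then have acc: "pd_sqrt A \<in> ?S" by (simp add: pos_def_iff)
  show "inv_into ?S ?sq A = pd_sqrt A"
    using g[OF acc] A by simp
  have "(inv_into ?S ?sq has_derivative lyapunov (pd_sqrt A)) (at (?sq (pd_sqrt A)))"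
  proof (rule has_derivative_inverse_strong[OF open_accretive acc _ g has_derivative_square])
    show "continuous_on ?S ?sq"
      by (intro bounded_bilinear.continuous_on[OF bounded_bilinear_matrix_mult] continuous_intros)
    show "(\<lambda>H. pd_sqrt A ** H + H ** pd_sqrt A) \<circ> lyapunov (pd_sqrt A) = id"
      using lyapunov_solves acc by (auto simp: fun_eq_iff)
  qed
  then show "(inv_into ?S ?sq has_derivative lyapunov (pd_sqrt A)) (at A)"
    by (simp add: A)
qed

lemma continuous_on_pd_sqrt: "continuous_on {A :: complex^'n^'n. pos_def A} pd_sqrt"
proof -
  obtain g :: "complex^'n^'n \<Rightarrow> complex^'n^'n" where g: "\<And>A. pos_def A \<Longrightarrow> g A = pd_sqrt A"
    "\<And>A. pos_def A \<Longrightarrow> (g has_derivative lyapunov (pd_sqrt A)) (at A)"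
    using pd_sqrt_differentiable_extension by blast 
  then have "continuous_on {A. pos_def A} g"
    by (auto intro!: continuous_at_imp_continuous_on has_derivative_continuous)
  then show ?thesis
    by (rule continuous_on_eq) (simp add: g)
qed

lemma has_vector_derivative_pd_sqrt:
  fixes \<gamma> :: "real \<Rightarrow> complex^'n^'n"
  assumes "(\<gamma> has_vector_derivative D) (at t)" "open T" "t \<in> T" "\<And>u. u \<in> T \<Longrightarrow> pos_def (\<gamma> u)"
  shows "((\<lambda>u. pd_sqrt (\<gamma> u)) has_vector_derivative lyapunov (pd_sqrt (\<gamma> t)) D) (at t)"
proof -
  obtain g :: "complex^'n^'n \<Rightarrow> complex^'n^'n" where g: "\<And>A. pos_def A \<Longrightarrow> g A = pd_sqrt A"
    "\<And>A. pos_def A \<Longrightarrow> (g has_derivative lyapunov (pd_sqrt A)) (at A)"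
    using pd_sqrt_differentiable_extension by blast
  have "linear (lyapunov (pd_sqrt (\<gamma> t)))"
    using pos_def_pd_sqrt[OF assms(4)[OF assms(3)]] by (intro linear_lyapunov) (simp add: pos_def_iff)
  moreover have "((g \<circ> \<gamma>) has_derivative lyapunov (pd_sqrt (\<gamma> t)) \<circ> (\<lambda>h. h *\<^sub>R D)) (at t)"
    using assms by (intro diff_chain_at g) (auto simp: has_vector_derivative_def)
  ultimately have "((g \<circ> \<gamma>) has_vector_derivative lyapunov (pd_sqrt (\<gamma> t)) D) (at t)"
    by (simp add: has_vector_derivative_def o_def linear_scale)
  then show ?thesis
    by (rule has_vector_derivative_transform_within_open[OF _ assms(2,3)]) (simp add: g assms(4))
qed

section \<open>Amplitudes and the fidelity\<close>

text \<open>Here \<open>N\<close> is an amplitude of \<open>S\<close>, a point in the fibre of \<open>N \<mapsto> N N\<^sup>*\<close> over \<open>S\<close>, and \<open>X N\<close> with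
  \<open>X = lyapunov S H\<close> is the horizontal lift of the tangent vector \<open>H\<close>. The lemma expresses that
  this map is a Riemannian submersion from the euclidean metric to the Bures-Wasserstein metric.\<close>

lemma bures_wasserstein_eq_norm:
  fixes S H :: "complex^'n^'n" and N :: "complex^'p^'n"
  assumes "pos_def S" "hermitian H" "N ** conj_transpose N = S"
  shows "bures_wasserstein S H H = (norm (lyapunov S H ** N))\<^sup>2"
proof -
  define X where "X = lyapunov S H"
  have X: "conj_transpose X = X" "S ** X + X ** S = H"
    using hermitian_lyapunov[OF assms(1,2)] lyapunov_solves[of S H] assms(1)
    by (auto simp: X_def hermitian_def pos_def_iff)
  have "trace (X ** (X ** S)) = trace (X ** (S ** X))"
    using trace_mul_sym[of X "X ** S"] by (simp add: matrix_mul_assoc)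
  moreover have "bures_wasserstein S H H = 1/2 * Re (trace (X ** (S ** X + X ** S)))"
    by (simp add: bures_wasserstein_def X_def[symmetric] X(2))
  ultimately have "bures_wasserstein S H H = Re (trace (X ** (S ** X)))"
    by (simp add: matrix_add_ldistrib trace_add)
  also have "X ** (S ** X) = (X ** N) ** conj_transpose (X ** N)"
    by (simp add: conj_transpose_mult X(1) assms(3)[symmetric] matrix_mul_assoc)
  also have "Re (trace \<dots>) = (norm (X ** N))\<^sup>2"
    by (simp only: trace_mult_conj_transpose Re_complex_of_real power2_norm_eq_inner)
  finally show ?thesis by (simp add: X_def)
qed

text \<open>The matrix \<open>T = s\<^sup>-\<^sup>1 (s S s)\<^sup>1\<^sup>/\<^sup>2 s\<^sup>-\<^sup>1\<close> is the geometric mean of \<open>S\<close> and \<open>s\<^sup>-\<^sup>2\<close>. The amplitudes \<open>s\<close> of \<open>s\<^sup>2\<close> and \<open>T s\<close> of \<open>S\<close> are aligned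
  optimally: their inner product is the trace of \<open>s (T s)\<close>, that is, the fidelity.\<close>

lemma fidelity_lift:
  fixes s S :: "complex^'n^'n"
  assumes "pos_def s" "pos_def S"
  obtains T where "pos_def T" "(T ** s) ** conj_transpose (T ** s) = S"
    "s ** (T ** s) = pd_sqrt (s ** S ** s)"
proof -
  obtain r where r: "s ** r = mat 1" "r ** s = mat 1" "hermitian r"
    using pos_def_inverse[OF assms(1)] by blast
  define G where "G = pd_sqrt (s ** S ** s)"
  have pd: "pos_def (s ** S ** s)"
    by (rule pos_def_congruence[OF assms(2) pos_def_hermitian[OF assms(1)] r(2)])
  have G: "pos_def G" "G ** G = s ** S ** s"
    using pos_def_pd_sqrt[OF pd] pd_sqrt_square[OF pd] by (auto simp: G_def)
  have Ts: "(r ** G ** r) ** s = r ** G"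
    by (simp add: matrix_mul_assoc[symmetric] r)
  have "(r ** G) ** conj_transpose (r ** G) = r ** (G ** G) ** r"
    using r(3) by (simp add: conj_transpose_mult hermitian_def pos_def_conj_transpose[OF G(1)] matrix_mul_assoc)
  also have "\<dots> = (r ** s) ** S ** (s ** r)"
    by (simp only: G(2) matrix_mul_assoc)
  finally have NN: "(r ** G) ** conj_transpose (r ** G) = S"
    by (simp add: r)
  show ?thesis
  proof (rule that)
    show "pos_def (r ** G ** r)"
      by (rule pos_def_congruence[OF G(1) r(3) r(1)])
    show "s ** ((r ** G ** r) ** s) = pd_sqrt (s ** S ** s)"
      by (simp only: Ts) (simp add: matrix_mul_assoc r G_def)
  qed (simp only: Ts NN)
qed

text \<open>The matrix inside the trace is the velocity of \<open>G = (s S s)\<^sup>1\<^sup>/\<^sup>2\<close> when \<open>S\<close> moves with velocity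
  \<open>S X + X S\<close>. Multiplying its Lyapunov equation by the inverse of \<open>G\<close> and taking traces yields twice
  its trace on one side and the two conjugate numbers \<open>tr (s X N)\<close> and \<open>tr (N\<^sup>* X s)\<close> on the other.\<close>

lemma Re_trace_lyapunov_sqrt:
  fixes s S X N :: "complex^'n^'n"
  assumes "pos_def G" "hermitian s" "hermitian X" "N ** conj_transpose N = S" "s ** N = G"
  shows "Re (trace (lyapunov G (s ** (S ** X + X ** S) ** s))) = s \<bullet> (X ** N)"
proof -
  define Y where "Y = lyapunov G (s ** (S ** X + X ** S) ** s)"
  obtain Q where Q: "G ** Q = mat 1" "Q ** G = mat 1"
    using pos_def_inverse[OF assms(1)] by blast
  have h: "conj_transpose s = s" "conj_transpose X = X" "conj_transpose G = G"
    using assms(1-3) by (auto simp: hermitian_def pos_def_conj_transpose)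
  have ctG: "conj_transpose N ** s = G"
    using arg_cong[OF assms(5), of conj_transpose] by (simp add: conj_transpose_mult h)
  have "trace (Q ** (Y ** G)) = trace Y"
    using trace_mul_sym[of Q "Y ** G"] by (simp add: matrix_mul_assoc[symmetric] Q)
  moreover have "Q ** (G ** Y) = Y"
    by (simp add: matrix_mul_assoc Q)
  ultimately have "2 * trace Y = trace (Q ** (G ** Y + Y ** G))"
    by (simp add: matrix_add_ldistrib trace_add)
  also have "G ** Y + Y ** G = s ** (S ** X + X ** S) ** s"
    using assms(1) unfolding Y_def by (intro lyapunov_solves) (simp add: pos_def_iff)
  also have "\<dots> = (s ** N) ** (conj_transpose N ** X ** s) + (s ** X ** N) ** (conj_transpose N ** s)"
    by (simp add: matrix_algebra assms(4)[symmetric] matrix_mul_assoc)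
  also have "\<dots> = G ** (conj_transpose N ** X ** s) + (s ** X ** N) ** G"
    by (simp only: assms(5) ctG)
  also have "Q ** \<dots> = conj_transpose N ** X ** s + Q ** ((s ** X ** N) ** G)"
    by (simp add: matrix_add_ldistrib matrix_mul_assoc Q)
  also have "trace \<dots> = trace (conj_transpose N ** X ** s) + trace (s ** X ** N)"
    using trace_mul_sym[of Q "(s ** X ** N) ** G"]
    by (simp add: trace_add matrix_mul_assoc[symmetric] Q)
  also have "conj_transpose N ** X ** s = conj_transpose (s ** X ** N)"
    by (simp add: conj_transpose_mult h matrix_mul_assoc)
  finally have "Re (2 * trace Y) = Re (cnj (trace (s ** X ** N)) + trace (s ** X ** N))"
    by (simp only: trace_conj_transpose)
  then have "Re (trace Y) = Re (trace (s ** X ** N))"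
    by simp
  then show ?thesis
    by (simp add: Y_def inner_matrix_eq_trace h matrix_mul_assoc)
qed

text \<open>A vector \<open>V\<close> tangent to the unit sphere at \<open>N\<close> only sees the component of \<open>s\<close> orthogonal to \<open>N\<close>, whose
  length is the sine of the angle between \<open>s\<close> and \<open>N\<close>.\<close>

lemma inner_le_sin_angle:
  fixes s N V :: "'a::real_inner"
  assumes "norm s = 1" "norm N = 1" "N \<bullet> V = 0"
  shows "\<bar>s \<bullet> V\<bar> \<le> norm V * sqrt (1 - (s \<bullet> N)\<^sup>2)"
proof -
  have 1: "s \<bullet> s = 1" "N \<bullet> N = 1"
    using assms by (auto simp: norm_eq_1)
  have "s \<bullet> V = (s - (s \<bullet> N) *\<^sub>R N) \<bullet> V"
    by (simp add: inner_diff_left assms(3))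
  also have "\<bar>\<dots>\<bar> \<le> norm (s - (s \<bullet> N) *\<^sub>R N) * norm V"
    by (rule Cauchy_Schwarz_ineq2)
  also have "norm (s - (s \<bullet> N) *\<^sub>R N) = sqrt (1 - (s \<bullet> N)\<^sup>2)"
    by (simp add: norm_eq_sqrt_inner inner_diff_left inner_diff_right 1 inner_commute[of N s]
        power2_eq_square)
  finally show ?thesis by (simp add: mult.commute)
qed

lemma trace_eq_1_imp_norm_lift:
  fixes S :: "complex^'n^'n"
  assumes "S \<in> density_matrices" "N ** conj_transpose N = S"
  shows "norm N = 1"
proof -
  have "complex_of_real (N \<bullet> N) = 1"
    using assms trace_mult_conj_transpose[of N] by (simp add: density_matrices_def)
  then show ?thesis
    by (simp add: norm_eq_1)
qed

text \<open>The fidelity is the inner product of the two aligned amplitudes, which are unit vectors.\<close>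

lemma fidelity_bounds:
  fixes \<sigma> S :: "complex^'n^'n"
  assumes "\<sigma> \<in> density_matrices" "S \<in> density_matrices"
  defines "F \<equiv> Re (trace (pd_sqrt (pd_sqrt \<sigma> ** S ** pd_sqrt \<sigma>)))"
  shows "0 < F" "F \<le> 1"
proof -
  define s where "s = pd_sqrt \<sigma>"
  have s: "pos_def s" "s ** s = \<sigma>" and S: "pos_def S"
    using assms(1,2) by (auto simp: s_def density_matrices_def pos_def_pd_sqrt pd_sqrt_square)
  have h: "conj_transpose s = s"
    by (rule pos_def_conj_transpose[OF s(1)])
  obtain T where T: "pos_def T" "(T ** s) ** conj_transpose (T ** s) = S"
    "s ** (T ** s) = pd_sqrt (s ** S ** s)"
    using fidelity_lift[OF s(1) S] by blast
  have F: "F = s \<bullet> (T ** s)"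
    by (simp add: F_def inner_matrix_eq_trace h T s_def[symmetric])
  have n: "norm s = 1" "norm (T ** s) = 1"
    using assms T h s(2) by (auto intro: trace_eq_1_imp_norm_lift)
  show "F \<le> 1"
    using norm_cauchy_schwarz[of s "T ** s"] by (simp add: F n)
  show "0 < F"
    unfolding F using T(1) n by (intro accretive_inner_left) (auto simp: pos_def_iff)
qed

text \<open>If \<open>F = cos \<alpha>\<close>, the estimate says that the angle \<open>\<alpha>\<close> changes at most as fast as the curve moves. It is
  proved pointwise: at the time \<open>t\<close> the amplitude \<open>N\<close> of \<open>\<gamma> t\<close> is chosen aligned with \<open>s = \<sigma>\<^sup>1\<^sup>/\<^sup>2\<close>, and then
  the derivative of \<open>F\<close> is the inner product of \<open>s\<close> with the horizontal velocity \<open>X N\<close>. The latter is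
  tangent to the unit sphere because the trace is constant along \<open>\<gamma>\<close>.\<close>

lemma fidelity_derivative:
  fixes \<gamma> :: "real \<Rightarrow> complex^'n^'n"
  assumes \<sigma>: "\<sigma> \<in> density_matrices"
    and \<gamma>: "(\<gamma> has_vector_derivative D) (at t)" "open T" "t \<in> T" "\<And>u. u \<in> T \<Longrightarrow> \<gamma> u \<in> density_matrices"
  defines "F \<equiv> \<lambda>u. Re (trace (pd_sqrt (pd_sqrt \<sigma> ** \<gamma> u ** pd_sqrt \<sigma>)))"
  obtains F' where "0 \<le> bures_wasserstein (\<gamma> t) D D" "(F has_real_derivative F') (at t)"
    "\<bar>F'\<bar> \<le> sqrt (bures_wasserstein (\<gamma> t) D D) * sqrt (1 - (F t)\<^sup>2)"
proof -
  define s where "s = pd_sqrt \<sigma>"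
  have s: "pos_def s" "s ** s = \<sigma>"
    using \<sigma> by (auto simp: s_def density_matrices_def pos_def_pd_sqrt pd_sqrt_square)
  have h: "conj_transpose s = s"
    by (rule pos_def_conj_transpose[OF s(1)])
  obtain r where r: "s ** r = mat 1" "r ** s = mat 1"
    using pos_def_inverse[OF s(1)] by blast
  have pd: "pos_def (\<gamma> u)" "pos_def (s ** \<gamma> u ** s)" if "u \<in> T" for u
    using \<gamma>(4)[OF that] pos_def_hermitian[OF s(1)] r
    by (auto simp: density_matrices_def intro!: pos_def_congruence[of _ s r])
  define S where "S = \<gamma> t"
  define X where "X = lyapunov S D"
  have S: "pos_def S" "S \<in> density_matrices"
    using pd \<gamma> by (auto simp: S_def)
  have X: "S ** X + X ** S = D"
    unfolding X_def using S(1) by (intro lyapunov_solves) (simp add: pos_def_iff)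
  obtain Q where Q: "(Q ** s) ** conj_transpose (Q ** s) = S" "s ** (Q ** s) = pd_sqrt (s ** S ** s)"
    using fidelity_lift[OF s(1) S(1)] by blast
  define N where "N = Q ** s"
  note N = Q[folded N_def]
  have n: "norm s = 1" "norm N = 1"
    using \<sigma> S(2) N h s(2) by (auto intro: trace_eq_1_imp_norm_lift)
  have "((\<lambda>u. trace (\<gamma> u)) has_vector_derivative trace D) (at t)"
    by (rule bounded_linear.has_vector_derivative[OF bounded_linear_trace \<gamma>(1)])
  moreover have "((\<lambda>u. trace (\<gamma> u)) has_vector_derivative 0) (at t)"
    by (rule has_vector_derivative_transform_within_open[OF _ \<gamma>(2,3), of "\<lambda>_. 1"])
      (use \<gamma>(4) in \<open>auto simp: density_matrices_def\<close>)
  ultimately have trD: "trace D = 0"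
    by (rule vector_derivative_unique_at)
  have "((\<lambda>u. conj_transpose (\<gamma> u)) has_vector_derivative conj_transpose D) (at t)"
    by (rule bounded_linear.has_vector_derivative[OF bounded_linear_conj_transpose \<gamma>(1)])
  moreover have "((\<lambda>u. conj_transpose (\<gamma> u)) has_vector_derivative D) (at t)"
    by (rule has_vector_derivative_transform_within_open[OF \<gamma>(1,2,3)])
      (use \<gamma>(4) in \<open>auto simp: density_matrices_def pos_def_conj_transpose\<close>)
  ultimately have hermD: "hermitian D"
    unfolding hermitian_def by (rule vector_derivative_unique_at)
  have hX: "hermitian X"
    unfolding X_def by (rule hermitian_lyapunov[OF S(1) hermD])
  have "2 * trace (X ** S) = 0"
    using trD trace_mul_sym[of S X] by (simp add: X[symmetric] trace_add)
  moreover have "trace (conj_transpose N ** (X ** N)) = trace (X ** S)"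
    using trace_mul_sym[of "conj_transpose N" "X ** N"]
    by (simp add: N(1) matrix_mul_assoc[symmetric])
  ultimately have NX: "N \<bullet> (X ** N) = 0"
    by (simp add: inner_matrix_eq_trace)
  have "((\<lambda>u. s ** \<gamma> u ** s) has_vector_derivative s ** D ** s) (at t)"
    by (intro bounded_linear.has_vector_derivative[OF bounded_bilinear.bounded_linear_left[OF bounded_bilinear_matrix_mult]]
        bounded_linear.has_vector_derivative[OF bounded_bilinear.bounded_linear_right[OF bounded_bilinear_matrix_mult]] \<gamma>(1))
  then have "((\<lambda>u. pd_sqrt (s ** \<gamma> u ** s)) has_vector_derivative
      lyapunov (pd_sqrt (s ** S ** s)) (s ** D ** s)) (at t)"
    unfolding S_def by (rule has_vector_derivative_pd_sqrt[OF _ \<gamma>(2,3)]) (rule pd)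
  then have "((\<lambda>u. Re (trace (pd_sqrt (s ** \<gamma> u ** s)))) has_vector_derivative
      Re (trace (lyapunov (pd_sqrt (s ** S ** s)) (s ** D ** s)))) (at t)"
    by (intro bounded_linear.has_vector_derivative[OF bounded_linear_Re]
        bounded_linear.has_vector_derivative[OF bounded_linear_trace])
  also have "Re (trace (lyapunov (pd_sqrt (s ** S ** s)) (s ** D ** s))) = s \<bullet> (X ** N)"
    unfolding X[symmetric] using s(1) hX N pd(2)[OF \<gamma>(3)]
    by (intro Re_trace_lyapunov_sqrt) (auto simp: S_def intro: pos_def_pd_sqrt pos_def_hermitian)
  finally have deriv: "(F has_real_derivative s \<bullet> (X ** N)) (at t)"
    by (simp add: F_def s_def[symmetric] has_real_derivative_iff_has_vector_derivative)
  have "F t = s \<bullet> N"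
    by (simp add: F_def s_def[symmetric] inner_matrix_eq_trace h N S_def[symmetric])
  moreover have norm: "bures_wasserstein S D D = (norm (X ** N))\<^sup>2"
    unfolding X_def by (rule bures_wasserstein_eq_norm[OF S(1) hermD N(1)])
  ultimately have "\<bar>s \<bullet> (X ** N)\<bar> \<le> sqrt (bures_wasserstein (\<gamma> t) D D) * sqrt (1 - (F t)\<^sup>2)"
    using inner_le_sin_angle[OF n NX] by (simp add: S_def)
  moreover have "0 \<le> bures_wasserstein (\<gamma> t) D D"
    using norm by (simp add: S_def)
  ultimately show ?thesis using deriv that by blast
qed

section \<open>Curves are at least as long as the angle\<close>

text \<open>The derivative is integrable in the sense of Henstock and Kurzweil, which makes it Lebesgue
  measurable. If the integral of its absolute value is infinite there is nothing to show, otherwise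
  the two integrals of the derivative agree. The absolute value of the derivative has the same
  nonnegative integral for Lebesgue measure as for its restriction to the Borel sets, where it is
  compared with \<open>h\<close>.\<close>

lemma nn_integral_ge_total_change:
  fixes \<phi> \<phi>' h :: "real \<Rightarrow> real"
  assumes "finite K" "continuous_on {0..1} \<phi>"
    and deriv: "\<And>t. t \<in> {0<..<1} - K \<Longrightarrow> (\<phi> has_real_derivative \<phi>' t) (at t)"
    and bound: "\<And>t. t \<in> {0<..<1} - K \<Longrightarrow> \<bar>\<phi>' t\<bar> \<le> h t"
  shows "ennreal (\<phi> 1 - \<phi> 0) \<le> (\<integral>\<^sup>+t\<in>{0..1}. ennreal (h t) \<partial>lborel)"
proof -
  let ?f = "\<lambda>t. indicator {0..1} t *\<^sub>R \<phi>' t"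
  have int: "(\<phi>' has_integral (\<phi> 1 - \<phi> 0)) {0..1}"
    using assms by (intro fundamental_theorem_of_calculus_interior_strong[of K])
      (auto simp: has_real_derivative_iff_has_vector_derivative)
  then have meas: "?f \<in> borel_measurable lebesgue"
    by (rule has_integral_implies_lebesgue_measurable)
  have "ennreal (\<phi> 1 - \<phi> 0) \<le> (\<integral>\<^sup>+t. ennreal (norm (?f t)) \<partial>lebesgue)"
  proof (cases "(\<integral>\<^sup>+t. ennreal (norm (?f t)) \<partial>lebesgue) < \<infinity>")
    case True
    with meas have f: "integrable lebesgue ?f"
      by (simp add: integrable_iff_bounded)
    then have "(?f has_integral (integral\<^sup>L lebesgue ?f)) UNIV"
      by (rule has_integral_integral_lebesgue)
    moreover have "?f = (\<lambda>t. if t \<in> {0..1} then \<phi>' t else 0)"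
      by auto
    with int have "(?f has_integral (\<phi> 1 - \<phi> 0)) UNIV"
      by (simp only: has_integral_restrict_UNIV)
    ultimately have "\<phi> 1 - \<phi> 0 = integral\<^sup>L lebesgue ?f"
      using has_integral_unique by blast
    then have "ennreal (\<phi> 1 - \<phi> 0) \<le> ennreal (norm (integral\<^sup>L lebesgue ?f))"
      by (intro ennreal_leI) simp
    also have "\<dots> \<le> (\<integral>\<^sup>+t. ennreal (norm (?f t)) \<partial>lebesgue)"
      by (rule integral_norm_bound_ennreal[OF f])
    finally show ?thesis .
  qed (simp add: less_top[symmetric])
  also have "\<dots> = (\<integral>\<^sup>+t. ennreal (norm (?f t)) \<partial>lborel)"
    by (rule nn_integral_completion)
  also have "\<dots> \<le> (\<integral>\<^sup>+t\<in>{0..1}. ennreal (h t) \<partial>lborel)"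
  proof (rule nn_integral_mono_AE, rule AE_I')
    show "insert 0 (insert 1 K) \<in> null_sets lborel"
      using assms(1) by (intro finite_imp_null_set_lborel) simp
    show "{t \<in> space lborel. \<not> ennreal (norm (?f t)) \<le> ennreal (h t) * indicator {0..1} t}
      \<subseteq> insert 0 (insert 1 K)"
      using bound by (auto simp: indicator_def intro!: ennreal_leI split: if_splits)
  qed
  finally show ?thesis .
qed

text \<open>The angle \<open>arccos F\<close> along the curve ends at \<open>0\<close> and decreases no faster than the curve moves. Since
  \<open>arccos\<close> is not differentiable where \<open>F = 1\<close>, the argument is run for \<open>arccos (c F)\<close> with \<open>0 < c < 1\<close>,
  whose derivative obeys the same bound because \<open>c\<^sup>2 (1 - F\<^sup>2) \<le> 1 - (c F)\<^sup>2\<close>; then \<open>c\<close> tends to \<open>1\<close>.\<close>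

lemma arccos_fidelity_le_curve_length:
  fixes \<gamma> :: "real \<Rightarrow> complex^'n^'n"
  assumes \<sigma>: "\<sigma> \<in> density_matrices"
    and \<gamma>: "valid_path \<gamma>" "path_image \<gamma> \<subseteq> density_matrices" "pathfinish \<gamma> = \<sigma>"
  shows "ennreal (arccos (Re (trace (pd_sqrt (pd_sqrt \<sigma> ** pathstart \<gamma> ** pd_sqrt \<sigma>)))))
    \<le> curve_length bures_wasserstein \<gamma>"
proof -
  define F where "F u = Re (trace (pd_sqrt (pd_sqrt \<sigma> ** \<gamma> u ** pd_sqrt \<sigma>)))" for u
  have s: "pos_def (pd_sqrt \<sigma>)" "pd_sqrt \<sigma> ** pd_sqrt \<sigma> = \<sigma>"
    using \<sigma> by (auto simp: density_matrices_def pos_def_pd_sqrt pd_sqrt_square)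
  obtain r where r: "r ** pd_sqrt \<sigma> = mat 1"
    using pos_def_inverse[OF s(1)] by blast
  have dens: "\<gamma> u \<in> density_matrices" if "u \<in> {0..1}" for u
    using \<gamma>(2) that by (auto simp: path_image_def)
  have F: "0 < F u" "F u \<le> 1" if "u \<in> {0..1}" for u
    using fidelity_bounds[OF \<sigma> dens[OF that]] by (auto simp: F_def)
  have "pd_sqrt \<sigma> ** \<sigma> ** pd_sqrt \<sigma> = \<sigma> ** \<sigma>"
    using s(2) by (metis matrix_mul_assoc)
  then have F1: "F 1 = 1"
    using \<sigma> \<gamma>(3) pd_sqrt_eqI[of \<sigma> "\<sigma> ** \<sigma>"]
    by (simp add: F_def pathfinish_def density_matrices_def)
  have F0: "F 0 = Re (trace (pd_sqrt (pd_sqrt \<sigma> ** pathstart \<gamma> ** pd_sqrt \<sigma>)))"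
    by (simp add: F_def pathstart_def)
  obtain K where K: "finite K" "\<gamma> C1_differentiable_on ({0..1} - K)" and cont: "continuous_on {0..1} \<gamma>"
    using \<gamma>(1) by (auto simp: valid_path_def piecewise_C1_differentiable_on_def)
  have "pos_def (pd_sqrt \<sigma> ** \<gamma> u ** pd_sqrt \<sigma>)" if "u \<in> {0..1}" for u
    using dens[OF that] r pos_def_hermitian[OF s(1)]
    by (auto simp: density_matrices_def intro!: pos_def_congruence[of _ _ r])
  then have contF: "continuous_on {0..1} F"
    unfolding F_def
    by (intro bounded_linear.continuous_on[OF bounded_linear_Re]
        bounded_linear.continuous_on[OF bounded_linear_trace]
        continuous_on_compose2[OF continuous_on_pd_sqrt]
        bounded_bilinear.continuous_on[OF bounded_bilinear_matrix_mult] continuous_on_const cont) auto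
  define D where "D t = vector_derivative \<gamma> (at t within {0..1})" for t
  define h where "h t = sqrt (bures_wasserstein (\<gamma> t) (D t) (D t))" for t
  have step: "ennreal (arccos (c * F 0) - arccos c) \<le> curve_length bures_wasserstein \<gamma>"
    if c: "c \<in> {0<..<1}" for c
  proof -
    \<comment> \<open>With the minus sign the total change of \<open>\<phi>\<close> is the decrease of the angle.\<close>
    define \<phi> where "\<phi> u = - arccos (c * F u)" for u
    have cF: "-1 < c * F u" "c * F u < 1" if "u \<in> {0..1}" for u
    proof -
      show "-1 < c * F u"
        using c F(1)[OF that] by (intro less_trans[OF _ mult_pos_pos]) auto
      have "c * F u \<le> c * 1"
        using c F(2)[OF that] by (intro mult_left_mono) auto
      also have "c * 1 < 1"
        using c by simp
      finally show "c * F u < 1" .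
    qed
    have "\<exists>d. (\<phi> has_real_derivative d) (at t) \<and> \<bar>d\<bar> \<le> h t" if t: "t \<in> {0<..<1} - K" for t
    proof -
      have t01: "t \<in> {0..1}" using t by auto
      have "(\<gamma> has_vector_derivative vector_derivative \<gamma> (at t)) (at t)"
        using K(2) t by (auto simp: C1_differentiable_on_eq vector_derivative_works[symmetric])
      moreover from this have "D t = vector_derivative \<gamma> (at t)"
        unfolding D_def using t by (intro vector_derivative_at_within_ivl) auto
      ultimately have "(\<gamma> has_vector_derivative D t) (at t)"
        by simp
      then obtain F' where nonneg: "0 \<le> bures_wasserstein (\<gamma> t) (D t) (D t)"
        and F': "(F has_real_derivative F') (at t)" "\<bar>F'\<bar> \<le> h t * sqrt (1 - (F t)\<^sup>2)"
        unfolding F_def h_def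
        by (rule fidelity_derivative[OF \<sigma>, where T = "{0<..<1}"]) (use t dens in auto)
      from nonneg have h: "0 \<le> h t"
        by (simp add: h_def)
      let ?w = "sqrt (1 - (c * F t)\<^sup>2)"
      have "(c * F t)\<^sup>2 < 1"
        using cF[OF t01] by (simp add: abs_square_less_1)
      then have w: "0 < ?w" by simp
      have "(\<phi> has_real_derivative - (inverse (- ?w) * (c * F'))) (at t)"
        unfolding \<phi>_def using cF[OF t01]
        by (intro DERIV_minus DERIV_chain2[OF DERIV_arccos] DERIV_cmult F'(1))
      moreover have "- (inverse (- ?w) * (c * F')) = c * F' / ?w"
        by (simp add: divide_inverse)
      moreover have "\<bar>c * F' / ?w\<bar> \<le> h t"
      proof -
        have "c * \<bar>F'\<bar> \<le> c * (h t * sqrt (1 - (F t)\<^sup>2))"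
          using F'(2) c by (intro mult_left_mono) auto
        also have "\<dots> = h t * sqrt (c\<^sup>2 * (1 - (F t)\<^sup>2))"
          using c by (simp add: real_sqrt_mult)
        also have "\<dots> \<le> h t * ?w"
          using h c by (intro mult_left_mono real_sqrt_le_mono)
            (auto simp: power_mult_distrib right_diff_distrib power_le_one)
        finally show ?thesis
          using w c by (simp add: abs_mult field_simps)
      qed
      ultimately show ?thesis by auto
    qed
    then obtain \<phi>' where \<phi>': "\<And>t. t \<in> {0<..<1} - K \<Longrightarrow> (\<phi> has_real_derivative \<phi>' t) (at t) \<and> \<bar>\<phi>' t\<bar> \<le> h t"
      by metis
    have "continuous_on {0..1} \<phi>"
      unfolding \<phi>_def using cF
      by (intro continuous_on_minus continuous_on_compose2[OF continuous_on_arccos'] continuous_intros contF)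
        (auto simp: less_imp_le)
    then have "ennreal (\<phi> 1 - \<phi> 0) \<le> (\<integral>\<^sup>+t\<in>{0..1}. ennreal (h t) \<partial>lborel)"
      by (rule nn_integral_ge_total_change[OF K(1)]) (use \<phi>' in auto)
    then show ?thesis
      by (simp add: \<phi>_def F1 curve_length_def h_def D_def)
  qed
  define c where "c n = 1 - inverse (real (Suc (Suc n)))" for n
  have c: "c n \<in> {0<..<1}" for n
    by (auto simp: c_def field_simps)
  have c_lim: "c \<longlonglongrightarrow> 1"
    using LIMSEQ_Suc[OF LIMSEQ_inverse_real_of_nat_add_minus[of 1]] by (simp add: c_def[abs_def])
  have "continuous_on {0..1} (\<lambda>c. arccos (c * F 0) - arccos c)"
    using F[of 0] by (intro continuous_intros continuous_on_compose2[OF continuous_on_arccos'])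
      (auto intro: mult_le_one order_trans[of "-1" 0])
  from continuous_on_tendsto_compose[OF this c_lim]
  have "(\<lambda>n. arccos (c n * F 0) - arccos (c n)) \<longlonglongrightarrow> arccos (1 * F 0) - arccos 1"
    using c by (auto simp: less_imp_le)
  then have "(\<lambda>n. ennreal (arccos (c n * F 0) - arccos (c n))) \<longlonglongrightarrow> ennreal (arccos (F 0))"
    by (intro tendsto_ennrealI) simp
  then have "ennreal (arccos (F 0)) \<le> curve_length bures_wasserstein \<gamma>"
    by (rule LIMSEQ_le_const2) (use step c in blast)
  then show ?thesis by (simp only: F0)
qed

section \<open>Great circles realize the angle\<close>

lemma pos_def_combination:
  assumes "pos_def A" "pos_def B" "0 \<le> a" "0 \<le> b" "0 < a + b"
  shows "pos_def (a *\<^sub>R A + b *\<^sub>R B)"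
proof -
  have "0 < a * (x \<bullet> (A *v x)) + b * (x \<bullet> (B *v x))" if "x \<noteq> 0" for x
  proof -
    have *: "0 < x \<bullet> (A *v x)" "0 < x \<bullet> (B *v x)"
      using assms(1,2) that by (auto simp: pos_def_iff accretive_def)
    show ?thesis
    proof (cases "0 < a")
      case True
      then show ?thesis using * assms(4) by (intro add_pos_nonneg mult_pos_pos mult_nonneg_nonneg) auto
    next
      case False
      then show ?thesis using * assms(3,5) by (intro add_nonneg_pos mult_pos_pos mult_nonneg_nonneg) auto
    qed
  qed
  then show ?thesis
    using assms(1,2)
    by (simp add: pos_def_iff accretive_def hermitian_def conj_transpose_add conj_transpose_scaleR
        matrix_vector_mult_add_rdistrib matrix_vector_mult_scaleR_left inner_add_right)
qed

text \<open>Up to the factor \<open>1 / sin (a + b)\<close> these are the position and the velocity of the great circle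
  through the unit vectors \<open>N\<close> and \<open>M\<close> at angle \<open>a + b\<close>.\<close>

lemma great_circle_identities:
  fixes M N :: "'a::real_inner"
  assumes "norm M = 1" "norm N = 1" "M \<bullet> N = cos (a + b)"
  shows "(norm (sin a *\<^sub>R N + sin b *\<^sub>R M))\<^sup>2 = (sin (a + b))\<^sup>2"
    and "(norm (cos b *\<^sub>R M - cos a *\<^sub>R N))\<^sup>2 = (sin (a + b))\<^sup>2"
proof -
  have 1: "M \<bullet> M = 1" "N \<bullet> N = 1" "N \<bullet> M = cos (a + b)"
    using assms by (auto simp: norm_eq_1 inner_commute)
  have *: "(sin a)\<^sup>2 = 1 - (cos a)\<^sup>2" "(sin b)\<^sup>2 = 1 - (cos b)\<^sup>2"
    by (simp_all add: sin_squared_eq)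
  have "(norm (sin a *\<^sub>R N + sin b *\<^sub>R M))\<^sup>2 = (sin a)\<^sup>2 + (sin b)\<^sup>2 + 2 * sin a * sin b * cos (a + b)"
    unfolding power2_norm_eq_inner
    by (simp add: inner_add_left inner_add_right 1 assms(3) power2_eq_square algebra_simps
        del: cos_add)
  also have "\<dots> = (sin (a + b))\<^sup>2"
    unfolding sin_add cos_add using * by algebra
  finally show "(norm (sin a *\<^sub>R N + sin b *\<^sub>R M))\<^sup>2 = (sin (a + b))\<^sup>2" .
  have "(norm (cos b *\<^sub>R M - cos a *\<^sub>R N))\<^sup>2 = (cos a)\<^sup>2 + (cos b)\<^sup>2 - 2 * cos a * cos b * cos (a + b)"
    unfolding power2_norm_eq_inner
    by (simp add: inner_diff_left inner_diff_right 1 assms(3) power2_eq_square algebra_simps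
        del: cos_add)
  also have "\<dots> = (sin (a + b))\<^sup>2"
    unfolding sin_add cos_add using * by algebra
  finally show "(norm (cos b *\<^sub>R M - cos a *\<^sub>R N))\<^sup>2 = (sin (a + b))\<^sup>2" .
qed

text \<open>The great circle from \<open>T s\<close> to \<open>s\<close> in the sphere of amplitudes has the form \<open>P t s\<close> with \<open>P t\<close> a
  nonnegative combination of \<open>T\<close> and the identity, hence positive definite. So the curve
  \<open>P t s\<^sup>2 P t\<close> stays among the density matrices. As \<open>P t\<close> commutes with its derivative \<open>Q t\<close>, the
  solution of the Lyapunov equation is \<open>Q t\<close> times the inverse of \<open>P t\<close>; it maps \<open>P t s\<close> to \<open>Q t s\<close>.
  The great circle is therefore horizontal, and its speed is the speed of the curve.\<close>

lemma great_circle_path: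
  fixes s T :: "complex^'n^'n"
  assumes s: "pos_def s" and T: "pos_def T"
    and n: "norm s = 1" "norm (T ** s) = 1"
    and \<theta>: "0 < \<theta>" "\<theta> < pi" "s \<bullet> (T ** s) = cos \<theta>"
  obtains \<gamma> where "valid_path \<gamma>" "path_image \<gamma> \<subseteq> density_matrices"
    "pathstart \<gamma> = (T ** s) ** conj_transpose (T ** s)" "pathfinish \<gamma> = s ** s"
    "curve_length bures_wasserstein \<gamma> = ennreal \<theta>"
proof -
  have herm: "conj_transpose s = s" "conj_transpose T = T"
    using s T by (auto simp: pos_def_conj_transpose)
  have sin: "0 < sin \<theta>"
    using \<theta> by (intro sin_gt_zero)
  \<comment> \<open>The angles from the moving point to the end point \<open>s\<close> and to the start point \<open>T s\<close>.\<close>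
  define a b where "a t = (1 - t) * \<theta>" and "b t = t * \<theta>" for t :: real
  have ab: "a t + b t = \<theta>" for t
    by (simp add: a_def b_def algebra_simps)
  define P where "P t = (sin (a t) / sin \<theta>) *\<^sub>R T + (sin (b t) / sin \<theta>) *\<^sub>R mat 1" for t
  define Q where "Q t = (- \<theta> * cos (a t) / sin \<theta>) *\<^sub>R T + (\<theta> * cos (b t) / sin \<theta>) *\<^sub>R mat 1" for t
  define \<gamma> where "\<gamma> t = P t ** (s ** s) ** P t" for t
  define D where "D t = P t ** (s ** s) ** Q t + Q t ** (s ** s) ** P t" for t
  have P_deriv: "(P has_vector_derivative Q t) (at t)" for t
    unfolding P_def[abs_def] Q_def a_def b_def
    using sin by (auto intro!: derivative_eq_intros simp: field_simps)
  have \<gamma>_deriv: "(\<gamma> has_vector_derivative D t) (at t)" for t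
  proof -
    note bb = bounded_bilinear.has_vector_derivative[OF bounded_bilinear_matrix_mult]
    have "((\<lambda>t. P t ** (s ** s)) has_vector_derivative Q t ** (s ** s)) (at t)"
      by (rule bounded_linear.has_vector_derivative[OF bounded_bilinear.bounded_linear_left[OF bounded_bilinear_matrix_mult] P_deriv])
    from bb[OF this P_deriv] show ?thesis
      by (simp add: \<gamma>_def[abs_def] D_def)
  qed
  have QP: "Q t ** P t = P t ** Q t" for t
    by (simp add: P_def Q_def matrix_algebra algebra_simps)
  have hermPQ: "conj_transpose (P t) = P t" "conj_transpose (Q t) = Q t" for t
    by (simp_all add: P_def Q_def conj_transpose_add conj_transpose_diff conj_transpose_scaleR herm)
  have lift: "\<gamma> t = (P t ** s) ** conj_transpose (P t ** s)" for t
    by (simp add: \<gamma>_def conj_transpose_mult herm hermPQ matrix_mul_assoc)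
  have Ps: "P t ** s = (1 / sin \<theta>) *\<^sub>R (sin (a t) *\<^sub>R (T ** s) + sin (b t) *\<^sub>R s)" for t
    by (simp add: P_def matrix_algebra scaleR_add_right)
  have Qs: "Q t ** s = (\<theta> / sin \<theta>) *\<^sub>R (cos (b t) *\<^sub>R s - cos (a t) *\<^sub>R (T ** s))" for t
    by (simp add: Q_def matrix_algebra scaleR_diff_right)
  have "s \<bullet> (T ** s) = cos (a t + b t)" for t
    by (simp add: ab \<theta>)
  note circle = great_circle_identities[OF n this, unfolded ab]
  have "norm (sin (a t) *\<^sub>R (T ** s) + sin (b t) *\<^sub>R s) = sin \<theta>" for t
    by (rule power2_eq_imp_eq[OF circle(1)]) (use sin in auto)
  then have normP: "norm (P t ** s) = 1" for t
    using sin by (simp add: Ps)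
  have "norm (cos (b t) *\<^sub>R s - cos (a t) *\<^sub>R (T ** s)) = sin \<theta>" for t
    by (rule power2_eq_imp_eq[OF circle(2)]) (use sin in auto)
  then have normQ: "norm (Q t ** s) = \<theta>" for t
    using sin \<theta> by (simp add: Qs)
  have P_pd: "pos_def (P t)" if t: "t \<in> {0..1}" for t
  proof -
    have ab0: "0 \<le> a t" "a t \<le> \<theta>" "0 \<le> b t" "b t \<le> \<theta>"
      using t \<theta> by (auto simp: a_def b_def mult_left_le_one_le)
    have nn: "0 \<le> sin (a t)" "0 \<le> sin (b t)"
      using ab0 \<theta> by (auto intro!: sin_ge_zero)
    have "0 < sin (a t) + sin (b t)"
    proof (cases "a t = 0")
      case True
      then have "b t = \<theta>" using ab[of t] by simp
      then show ?thesis using sin nn(1) by simp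
    next
      case False
      then have "0 < sin (a t)"
        using ab0 \<theta> by (intro sin_gt_zero) auto
      then show ?thesis using nn(2) by simp
    qed
    then show ?thesis
      unfolding P_def using nn sin T
      by (intro pos_def_combination)
        (auto simp: pos_def_iff accretive_mat_1 hermitian_def add_divide_distrib[symmetric])
  qed
  have dens: "\<gamma> t \<in> density_matrices" if t: "t \<in> {0..1}" for t
  proof -
    obtain R where R: "P t ** R = mat 1" "R ** P t = mat 1"
      using pos_def_inverse[OF P_pd[OF t]] by blast
    obtain r where r: "r ** s = mat 1"
      using pos_def_inverse[OF s] by blast
    have "pos_def (s ** mat 1 ** s)"
      by (rule pos_def_congruence[OF _ pos_def_hermitian[OF s] r])
        (simp add: pos_def_iff accretive_mat_1 hermitian_def)
    then have "pos_def (\<gamma> t)"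
      unfolding \<gamma>_def
      by (intro pos_def_congruence[OF _ pos_def_hermitian[OF P_pd[OF t]] R(2)]) simp
    moreover have "trace (\<gamma> t) = 1"
      using normP[of t] by (simp only: lift trace_mult_conj_transpose norm_eq_1 of_real_1)
    ultimately show ?thesis
      by (simp add: density_matrices_def)
  qed
  have speed: "sqrt (bures_wasserstein (\<gamma> t) (D t) (D t)) = \<theta>" if t: "t \<in> {0..1}" for t
  proof -
    obtain R where R: "P t ** R = mat 1" "R ** P t = mat 1"
      using pos_def_inverse[OF P_pd[OF t]] by blast
    have pd: "pos_def (\<gamma> t)"
      using dens[OF t] by (simp add: density_matrices_def)
    have RQ: "R ** Q t = Q t ** R"
      by (metis QP R matrix_mul_assoc matrix_mul_lid matrix_mul_rid)
    have "\<gamma> t ** (Q t ** R) = P t ** (s ** s) ** (P t ** R) ** Q t"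
      by (simp only: \<gamma>_def RQ[symmetric] matrix_mul_assoc)
    moreover have "(Q t ** R) ** \<gamma> t = Q t ** (R ** P t) ** (s ** s) ** P t"
      by (simp only: \<gamma>_def matrix_mul_assoc)
    ultimately have "\<gamma> t ** (Q t ** R) + (Q t ** R) ** \<gamma> t = D t"
      by (simp add: R D_def)
    then have X: "lyapunov (\<gamma> t) (D t) = Q t ** R"
      by (rule lyapunov_eqI[OF pos_def_accretive[OF pd]])
    have "hermitian (D t)"
      by (simp add: hermitian_def D_def conj_transpose_add conj_transpose_mult hermPQ herm
          matrix_mul_assoc add.commute)
    then have "bures_wasserstein (\<gamma> t) (D t) (D t) = (norm ((Q t ** R) ** (P t ** s)))\<^sup>2"
      using bures_wasserstein_eq_norm[OF pd _ lift[symmetric]] by (simp add: X)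
    also have "(Q t ** R) ** (P t ** s) = Q t ** (R ** P t) ** s"
      by (simp only: matrix_mul_assoc)
    finally show ?thesis
      using \<theta> by (simp add: R normQ)
  qed
  show ?thesis
  proof (rule that)
    have "continuous_on UNIV P" "continuous_on UNIV Q"
      unfolding P_def[abs_def] Q_def[abs_def] a_def b_def
      using sin by (auto intro!: continuous_intros)
    then have "continuous_on UNIV D"
      unfolding D_def[abs_def]
      by (intro continuous_on_add continuous_on_const
          bounded_bilinear.continuous_on[OF bounded_bilinear_matrix_mult])
    then have "\<gamma> C1_differentiable_on {0..1}"
      unfolding C1_differentiable_on_def using \<gamma>_deriv continuous_on_subset by blast
    then show "valid_path \<gamma>"
      by (simp add: valid_path_def C1_differentiable_imp_piecewise)
    show "path_image \<gamma> \<subseteq> density_matrices"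
      using dens by (auto simp: path_image_def)
    show "pathstart \<gamma> = (T ** s) ** conj_transpose (T ** s)"
      using sin by (simp add: pathstart_def lift P_def a_def b_def)
    show "pathfinish \<gamma> = s ** s"
      using sin by (simp add: pathfinish_def \<gamma>_def P_def a_def b_def)
    have "vector_derivative \<gamma> (at t within {0..1}) = D t" if "t \<in> {0..1}" for t
      using that by (intro vector_derivative_at_within_ivl[OF \<gamma>_deriv]) auto
    then have "curve_length bures_wasserstein \<gamma> = (\<integral>\<^sup>+t\<in>{0..1::real}. ennreal \<theta> \<partial>lborel)"
      unfolding curve_length_def
      by (intro nn_integral_cong) (auto simp: indicator_def speed)
    also have "\<dots> = ennreal \<theta>"
      by (simp add: nn_integral_cmult_indicator)
    finally show "curve_length bures_wasserstein \<gamma> = ennreal \<theta>" .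
  qed
qed

text \<open>Serves the case of coinciding end points, where no great circle is singled out.\<close>

lemma curve_length_const:
  assumes "accretive p"
  shows "curve_length bures_wasserstein (\<lambda>_. p) = 0"
proof -
  have "vector_derivative (\<lambda>_. p) (at t within {0..1}) = 0" if "t \<in> {0..1}" for t :: real
    using that by (intro vector_derivative_at_within_ivl) auto
  moreover have "lyapunov p 0 = 0"
    by (rule lyapunov_eqI[OF assms]) simp
  ultimately have "curve_length bures_wasserstein (\<lambda>_. p) = (\<integral>\<^sup>+t. 0 \<partial>(lborel :: real measure))"
    unfolding curve_length_def
    by (intro nn_integral_cong) (auto simp: indicator_def bures_wasserstein_def trace_def)
  then show ?thesis by simp
qed

text \<open>The lower bound applies to each competing curve. For the upper bound the great circle of angle
  \<open>arccos F\<close> is used if \<open>F < 1\<close>; if \<open>F = 1\<close>, the aligned unit amplitudes coincide, and so do their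
  density matrices.\<close>

theorem theorem6:
  fixes \<rho>1 \<rho>2 :: "complex^'n^'n"
  assumes "\<rho>1 \<in> density_matrices" and "\<rho>2 \<in> density_matrices"
  shows "riemannian_distance density_matrices bures_wasserstein \<rho>1 \<rho>2 =
    ennreal (arccos (Re (trace (pd_sqrt (pd_sqrt \<rho>2 ** \<rho>1 ** pd_sqrt \<rho>2)))))"
proof (rule antisym)
  define F where "F = Re (trace (pd_sqrt (pd_sqrt \<rho>2 ** \<rho>1 ** pd_sqrt \<rho>2)))"
  define s where "s = pd_sqrt \<rho>2"
  have s: "pos_def s" "s ** s = \<rho>2" and \<rho>: "pos_def \<rho>1" "pos_def \<rho>2"
    using assms by (auto simp: s_def density_matrices_def pos_def_pd_sqrt pd_sqrt_square)
  note herm = pos_def_conj_transpose[OF s(1)]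
  obtain T where T: "pos_def T" "(T ** s) ** conj_transpose (T ** s) = \<rho>1"
    "s ** (T ** s) = pd_sqrt (s ** \<rho>1 ** s)"
    using fidelity_lift[OF s(1) \<rho>(1)] by blast
  have n: "norm s = 1" "norm (T ** s) = 1"
    using trace_eq_1_imp_norm_lift[OF assms(2), of s] trace_eq_1_imp_norm_lift[OF assms(1) T(2)]
    by (simp_all add: herm s)
  have F: "s \<bullet> (T ** s) = F"
    by (simp add: F_def inner_matrix_eq_trace herm T s_def[symmetric])
  have bounds: "0 < F" "F \<le> 1"
    using fidelity_bounds[OF assms(2,1)] by (auto simp: F_def)
  obtain \<gamma> where \<gamma>: "valid_path \<gamma>" "path_image \<gamma> \<subseteq> density_matrices" "pathstart \<gamma> = \<rho>1"
    "pathfinish \<gamma> = \<rho>2" "curve_length bures_wasserstein \<gamma> = ennreal (arccos F)"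
  proof (cases "F = 1")
    case True
    have "(norm (s - T ** s))\<^sup>2 = 0"
      using n True F unfolding power2_norm_eq_inner
      by (simp add: inner_diff_left inner_diff_right norm_eq_1 inner_commute[of "T ** s" s])
    then have "s = T ** s" by simp
    then have eq: "\<rho>1 = \<rho>2"
      using T(2) s(2) herm by simp
    show ?thesis
      by (rule that[of "\<lambda>_. \<rho>1"])
        (use True eq assms \<rho> in \<open>auto simp: pathstart_def pathfinish_def path_image_def
          curve_length_const pos_def_accretive valid_path_def
          intro!: C1_differentiable_imp_piecewise\<close>)
  next
    case False
    have "0 < arccos F" "arccos F < pi" "s \<bullet> (T ** s) = cos (arccos F)"
      using bounds False F arccos_lt_bounded[of F] by auto
    from great_circle_path[OF s(1) T(1) n this] show ?thesis
      using that T(2) s(2) by metis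
  qed
  then show "riemannian_distance density_matrices bures_wasserstein \<rho>1 \<rho>2
      \<le> ennreal (arccos (Re (trace (pd_sqrt (pd_sqrt \<rho>2 ** \<rho>1 ** pd_sqrt \<rho>2)))))"
    unfolding riemannian_distance_def F_def[symmetric] by (intro INF_lower2[of \<gamma>]) auto
next
  show "ennreal (arccos (Re (trace (pd_sqrt (pd_sqrt \<rho>2 ** \<rho>1 ** pd_sqrt \<rho>2)))))
      \<le> riemannian_distance density_matrices bures_wasserstein \<rho>1 \<rho>2"
    unfolding riemannian_distance_def
    by (intro INF_greatest) (use arccos_fidelity_le_curve_length[OF assms(2)] in auto)
qed

end
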